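(* Let $\epsilon\in\{1,-1\}$, let $m$ be an integer with $m\ge1$ if $\epsilon=-1$ and $m\ge2$ if $\epsilon=1$, and let $f(x)=(x+\tfrac12)^m$. Run Algorithm TCF (defined in the context) on $(f,\epsilon)$. Then the following two statements are equivalent. (A) For every $k\ge1$ (in particular $N_k(x)$ is defined and non-zero for every $k\ge 1$), $$\deg N_k(x)=\begin{cases}2\left\lfloor\dfrac{m-1}{2}\right\rfloor,&\epsilon=-1,\\[2mm] 2\left\lfloor\dfrac{m-2}{2}\right\rfloor,&\epsilon=1.\end{cases}$$ (B) The algorithm never terminates, and it generates: for $\epsilon=-1$: (i) $b_k(x)=x$ for all $k\ge2$, when $m$ is odd; (ii) $b_k(x)=x^2+c_k$ for all $k\ge2$, with constants $c_k$, when $m$ is even; for $\epsilon=1$: (i) $b_k(x)=x$ for all $k\ge2$, when $m$ is even; (ii) $b_k(x)=x^2+c_k$ for all $k\ge2$, with constants $c_k$, when $m$ is odd.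
   Context: Given constants $a_1,a_2,\dots$ and polynomials $b_1(x),b_2(x),\dots$, define $p_{-1}=1$, $q_{-1}=0$, $p_0=0$, $q_0=1$ and, for $k\ge1$, $p_k(x)=b_k(x)p_{k-1}(x)+a_kp_{k-2}(x)$, $q_k(x)=b_k(x)q_{k-1}(x)+a_kq_{k-2}(x)$. Define $$N_k(x)=q_k(x)q_k(x+1)-f(x)\bigl(p_k(x)q_k(x+1)-\epsilon p_k(x+1)q_k(x)\bigr)\quad (k\ge -1),$$ and for $k\ge0$ $$E_k(x)=q_k(x)q_{k-1}(x+1)-f(x)\bigl(p_k(x)q_{k-1}(x+1)-\epsilon p_{k-1}(x+1)q_k(x)\bigr),$$ $$F_k(x)=q_{k-1}(x)q_k(x+1)-f(x)\bigl(p_{k-1}(x)q_k(x+1)-\epsilon p_k(x+1)q_{k-1}(x)\bigr).$$ In particular $N_{-1}=0$, $N_0=1$, $E_0=\epsilon f$, $F_0=-f$, and for $k\ge1$ $$N_k(x)=b_k(x)b_k(x+1)N_{k-1}(x)+a_k^2N_{k-2}(x)+a_kb_k(x)E_{k-1}(x)+a_kb_k(x+1)F_{k-1}(x).\qquad( * )$$ Algorithm TCF. For $k=1,2,3,\dots$, given $a_j,b_j(x)$ for $j<k$: if $N_{k-1}(x)=0$ identically, stop (terminate). Otherwise set $$d_k=\begin{cases}\deg E_{k-1}(x)-\deg N_{k-1}(x),&\epsilon=-1,\\ \deg E_{k-1}(x)-1-\deg N_{k-1}(x),&\epsilon=1,\end{cases}$$ take $b_k(x)$ to be a monic polynomial of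 degree $d_k$ with $d_k$ unknown non-leading coefficients, and let $a_k$ be an unknown constant. Require the top $d_k+1$ coefficients of the right-hand side of $( * )$, i.e. the coefficients of $x^{2d_k+q},x^{2d_k+q-1},\dots,x^{d_k+q}$ with $q=\deg N_{k-1}(x)$, to be zero. This gives $d_k+1$ equations in the $d_k+1$ unknowns (all unknowns rational). If the system has a unique solution, use it to define $a_k$ and $b_k(x)$ and continue with $k+1$; if it has no solution or several, the algorithm terminates. *)

theory Defs
  imports "HOL-Computational_Algebra.Polynomial"
begin

text \<open>
  The numerators and denominators of the continued fraction, and the polynomials \<open>N\<close> built from
  them, start at index -1. They are stored shifted by one: \<open>cf_p a b n\<close>, \<open>cf_q a b n\<close> and
  \<open>cf_N f \<epsilon> a b n\<close> are $p_{n-1}$, $q_{n-1}$ and $N_{n-1}$. There is no shift for \<open>a\<close>, \<open>b\<close>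
  (used at indices from 1 on) or for \<open>cf_E\<close>, \<open>cf_F\<close> (indices from 0 on).
\<close>

fun cf_p :: "(nat \<Rightarrow> rat) \<Rightarrow> (nat \<Rightarrow> rat poly) \<Rightarrow> nat \<Rightarrow> rat poly" where
  "cf_p a b 0 = 1"
| "cf_p a b (Suc 0) = 0"
| "cf_p a b (Suc (Suc n)) = b (Suc n) * cf_p a b (Suc n) + smult (a (Suc n)) (cf_p a b n)"

fun cf_q :: "(nat \<Rightarrow> rat) \<Rightarrow> (nat \<Rightarrow> rat poly) \<Rightarrow> nat \<Rightarrow> rat poly" where
  "cf_q a b 0 = 0"
| "cf_q a b (Suc 0) = 1"
| "cf_q a b (Suc (Suc n)) = b (Suc n) * cf_q a b (Suc n) + smult (a (Suc n)) (cf_q a b n)"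

definition shift1 :: "rat poly \<Rightarrow> rat poly" where
  "shift1 g = pcompose g [:1, 1:]"

definition cf_N ::
  "rat poly \<Rightarrow> rat \<Rightarrow> (nat \<Rightarrow> rat) \<Rightarrow> (nat \<Rightarrow> rat poly) \<Rightarrow> nat \<Rightarrow> rat poly" where
  "cf_N f \<epsilon> a b n =
     cf_q a b n * shift1 (cf_q a b n)
     - f * (cf_p a b n * shift1 (cf_q a b n) - smult \<epsilon> (shift1 (cf_p a b n) * cf_q a b n))"

definition cf_E ::
  "rat poly \<Rightarrow> rat \<Rightarrow> (nat \<Rightarrow> rat) \<Rightarrow> (nat \<Rightarrow> rat poly) \<Rightarrow> nat \<Rightarrow> rat poly" where
  "cf_E f \<epsilon> a b k =
     cf_q a b (Suc k) * shift1 (cf_q a b k)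
     - f * (cf_p a b (Suc k) * shift1 (cf_q a b k)
            - smult \<epsilon> (shift1 (cf_p a b k) * cf_q a b (Suc k)))"

definition cf_F ::
  "rat poly \<Rightarrow> rat \<Rightarrow> (nat \<Rightarrow> rat) \<Rightarrow> (nat \<Rightarrow> rat poly) \<Rightarrow> nat \<Rightarrow> rat poly" where
  "cf_F f \<epsilon> a b k =
     cf_q a b k * shift1 (cf_q a b (Suc k))
     - f * (cf_p a b k * shift1 (cf_q a b (Suc k))
            - smult \<epsilon> (shift1 (cf_p a b (Suc k)) * cf_q a b k))"

text \<open>
  The next three definitions describe step $k = n + 1$ of the algorithm, so that
  $N_{k-1}$, $N_{k-2}$, $E_{k-1}$, $F_{k-1}$ are \<open>cf_N (Suc n)\<close>, \<open>cf_N n\<close>, \<open>cf_E n\<close>, \<open>cf_F n\<close>;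
  \<open>\<alpha>\<close> and \<open>\<beta>\<close> are the candidates for $a_k$ and $b_k$.
\<close>

definition tcf_rhs ::
  "rat poly \<Rightarrow> rat \<Rightarrow> (nat \<Rightarrow> rat) \<Rightarrow> (nat \<Rightarrow> rat poly) \<Rightarrow> nat \<Rightarrow> rat \<Rightarrow> rat poly \<Rightarrow> rat poly" where
  "tcf_rhs f \<epsilon> a b n \<alpha> \<beta> =
     \<beta> * shift1 \<beta> * cf_N f \<epsilon> a b (Suc n)
     + smult (\<alpha>\<^sup>2) (cf_N f \<epsilon> a b n)
     + smult \<alpha> (\<beta> * cf_E f \<epsilon> a b n)
     + smult \<alpha> (shift1 \<beta> * cf_F f \<epsilon> a b n)"

definition tcf_deg ::
  "rat poly \<Rightarrow> rat \<Rightarrow> (nat \<Rightarrow> rat) \<Rightarrow> (nat \<Rightarrow> rat poly) \<Rightarrow> nat \<Rightarrow> int" where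
  "tcf_deg f \<epsilon> a b n =
     int (degree (cf_E f \<epsilon> a b n)) - (if \<epsilon> = 1 then 1 else 0)
     - int (degree (cf_N f \<epsilon> a b (Suc n)))"

text \<open>
  If \<open>tcf_deg\<close> is negative, no \<open>\<beta>\<close> has that degree, so the system has no solution.
  Since \<open>degree 0 = 0\<close> in the library, the case $E_{k-1} = 0$, in which $\deg E_{k-1}$ is not a
  natural number, is excluded explicitly: then, too, there is no solution.
\<close>

definition tcf_solution ::
  "rat poly \<Rightarrow> rat \<Rightarrow> (nat \<Rightarrow> rat) \<Rightarrow> (nat \<Rightarrow> rat poly) \<Rightarrow> nat \<Rightarrow> rat \<times> rat poly \<Rightarrow> bool" where
  "tcf_solution f \<epsilon> a b n = (\<lambda>(\<alpha>, \<beta>).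
     cf_E f \<epsilon> a b n \<noteq> 0 \<and>
     lead_coeff \<beta> = 1 \<and> int (degree \<beta>) = tcf_deg f \<epsilon> a b n \<and>
     (let d = degree \<beta>; q = degree (cf_N f \<epsilon> a b (Suc n)) in
       \<forall>i\<in>{d + q..2 * d + q}. coeff (tcf_rhs f \<epsilon> a b n \<alpha> \<beta>) i = 0))"

text \<open>
  \<open>tcf_run f \<epsilon> k\<close> is \<open>Some (a, b)\<close>, with \<open>a j\<close>, \<open>b j\<close> for \<open>1 \<le> j \<le> k\<close> the generated values (and 0
  at all other indices), if the first \<open>k\<close> steps are carried out; it is \<open>None\<close> if the algorithm
  terminates at one of them.
\<close>

primrec tcf_run ::
  "rat poly \<Rightarrow> rat \<Rightarrow> nat \<Rightarrow> ((nat \<Rightarrow> rat) \<times> (nat \<Rightarrow> rat poly)) option" where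
  "tcf_run f \<epsilon> 0 = Some (\<lambda>_. 0, \<lambda>_. 0)"
| "tcf_run f \<epsilon> (Suc n) =
     (case tcf_run f \<epsilon> n of
        None \<Rightarrow> None
      | Some (a, b) \<Rightarrow>
          if cf_N f \<epsilon> a b (Suc n) \<noteq> 0 \<and> (\<exists>!s. tcf_solution f \<epsilon> a b n s)
          then (let (\<alpha>, \<beta>) = (THE s. tcf_solution f \<epsilon> a b n s)
                in Some (a(Suc n := \<alpha>), b(Suc n := \<beta>)))
          else None)"

end

theory Submission
  imports Defs
begin

text \<open>
  Put $M = m$ for $\epsilon = -1$ and $M = m - 1$ for $\epsilon = 1$. The system solved at step $k$
  says exactly that $\deg N_k < d_k + \deg N_{k-1} = M$. The identity
  $E_k F_k = N_k N_{k-1} - \epsilon (a_1 \cdots a_k)^2 f^2$ then forces $\deg E_k = \deg F_k = m$,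
  so that $\deg b_{k+1} = M - \deg N_k$ at every step, and the degrees of $N_k$ and $b_{k+1}$
  determine each other. The reflection $x \mapsto -1-x$ fixes $N_k$ and swaps $E_k$ and $F_k$ up to a
  sign $s$ independent of $k$, hence maps solutions of the system to solutions; uniqueness gives
  $b_k(-x) = s\,b_k(x)$, which leaves only $x$ and $x^2 + c$ in degrees 1 and 2.
\<close>

section \<open>Locality of the recurrences, and the shift x -> x + 1\<close>

lemma cf_p_cong:
  "(\<And>i. 1 \<le> i \<Longrightarrow> i < n \<Longrightarrow> a i = a' i \<and> b i = b' i) \<Longrightarrow> cf_p a b n = cf_p a' b' n"
  by (induction a b n rule: cf_p.induct) auto

lemma cf_q_cong:
  "(\<And>i. 1 \<le> i \<Longrightarrow> i < n \<Longrightarrow> a i = a' i \<and> b i = b' i) \<Longrightarrow> cf_q a b n = cf_q a' b' n"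
  by (induction a b n rule: cf_q.induct) auto

lemma shift1_add: "shift1 (g + h) = shift1 g + shift1 h"
  by (simp add: shift1_def pcompose_add)

lemma shift1_mult: "shift1 (g * h) = shift1 g * shift1 h"
  by (simp add: shift1_def pcompose_mult)

lemma shift1_smult: "shift1 (smult c g) = smult c (shift1 g)"
  by (simp add: shift1_def pcompose_smult)

lemma degree_shift1: "degree (shift1 g) = degree g"
  by (simp add: shift1_def degree_pcompose)

lemma lead_coeff_shift1: "lead_coeff (shift1 g) = lead_coeff g"
  by (simp add: shift1_def lead_coeff_comp)

text \<open>The leading terms cancel. Truncated subtraction is harmless for constants, since the
  shift fixes them and the difference is 0.\<close>

lemma degree_shift1_diff: "degree (shift1 g - g) \<le> degree g - 1"
proof (cases "degree g = 0")
  case True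
  then obtain c where "g = [:c:]"
    using degree_eq_zeroE by blast
  then show ?thesis
    by (simp add: shift1_def)
next
  case False
  have "coeff (shift1 g - g) i = 0" if "i > degree g - 1" for i
  proof (cases "i = degree g")
    case True
    then show ?thesis
      using lead_coeff_shift1[of g] by (simp add: degree_shift1)
  next
    case False
    with that have "i > degree g"
      by simp
    then show ?thesis
      by (simp add: coeff_eq_0 degree_shift1)
  qed
  then show ?thesis
    by (intro degree_le) simp
qed

lemmas shift1_simps = shift1_add shift1_mult shift1_smult

section \<open>Recurrences for E, F and N\<close>

lemma cf_E_Suc:
  "cf_E f \<epsilon> a b (Suc n) = b (Suc n) * cf_N f \<epsilon> a b (Suc n) + smult (a (Suc n)) (cf_F f \<epsilon> a b n)"
  by (simp add: cf_E_def cf_F_def cf_N_def algebra_simps smult_add_right smult_diff_right)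

lemma cf_F_Suc:
  "cf_F f \<epsilon> a b (Suc n) =
     shift1 (b (Suc n)) * cf_N f \<epsilon> a b (Suc n) + smult (a (Suc n)) (cf_E f \<epsilon> a b n)"
  by (simp add: cf_E_def cf_F_def cf_N_def shift1_simps algebra_simps smult_add_right
      smult_diff_right)

lemma cf_N_Suc_Suc:
  "cf_N f \<epsilon> a b (Suc (Suc n)) = tcf_rhs f \<epsilon> a b n (a (Suc n)) (b (Suc n))"
  by (simp add: tcf_rhs_def cf_E_def cf_F_def cf_N_def shift1_simps algebra_simps smult_add_right
      smult_diff_right power2_eq_square)

text \<open>A step of the run overwrites only the entry at its own index, so quantities formed from
  earlier entries survive it.\<close>

lemma cf_N_cong:
  assumes "\<And>i. 1 \<le> i \<Longrightarrow> i < n \<Longrightarrow> a i = a' i \<and> b i = b' i"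
  shows "cf_N f \<epsilon> a b n = cf_N f \<epsilon> a' b' n"
  using cf_p_cong[OF assms] cf_q_cong[OF assms] by (simp add: cf_N_def)

lemma cf_EF_cong:
  assumes "\<And>i. 1 \<le> i \<Longrightarrow> i \<le> n \<Longrightarrow> a i = a' i \<and> b i = b' i"
  shows "cf_E f \<epsilon> a b n = cf_E f \<epsilon> a' b' n" "cf_F f \<epsilon> a b n = cf_F f \<epsilon> a' b' n"
  using assms cf_p_cong[of n a a' b b'] cf_q_cong[of n a a' b b']
    cf_p_cong[of "Suc n" a a' b b'] cf_q_cong[of "Suc n" a a' b b']
  by (simp_all add: cf_E_def cf_F_def)

text \<open>Trades the definite description in \<open>tcf_run\<close> for a concrete solution
  together with a uniqueness rule.\<close>

lemma tcf_run_SucE: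
  assumes "tcf_run f \<epsilon> (Suc n) = Some (a, b)"
  obtains a' b' \<alpha> \<beta> where "tcf_run f \<epsilon> n = Some (a', b')"
    and "cf_N f \<epsilon> a' b' (Suc n) \<noteq> 0" and "tcf_solution f \<epsilon> a' b' n (\<alpha>, \<beta>)"
    and "\<And>\<alpha>' \<beta>'. tcf_solution f \<epsilon> a' b' n (\<alpha>', \<beta>') \<Longrightarrow> \<alpha>' = \<alpha> \<and> \<beta>' = \<beta>"
    and "a = a'(Suc n := \<alpha>)" and "b = b'(Suc n := \<beta>)"
proof -
  from assms obtain a' b' where run: "tcf_run f \<epsilon> n = Some (a', b')"
    by (auto split: option.splits)
  with assms have N: "cf_N f \<epsilon> a' b' (Suc n) \<noteq> 0"
    and ex1: "\<exists>!s. tcf_solution f \<epsilon> a' b' n s"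
    by (auto split: if_splits)
  obtain \<alpha> \<beta> where the: "(THE s. tcf_solution f \<epsilon> a' b' n s) = (\<alpha>, \<beta>)"
    by fastforce
  have sol: "tcf_solution f \<epsilon> a' b' n (\<alpha>, \<beta>)"
    using theI'[OF ex1] the by simp
  have "Some (a, b) = Some (a'(Suc n := \<alpha>), b'(Suc n := \<beta>))"
    using assms run N ex1 the by simp
  then show ?thesis
    using that[OF run N sol] ex1 sol by blast
qed

section \<open>The reflection x -> -1 - x\<close>

text \<open>The fixed point -1/2 is the zero of f, so f is preserved up to sign.\<close>

definition reflect :: "rat poly \<Rightarrow> rat poly" where
  "reflect g = pcompose g [:-1, -1:]"

lemma reflect_simps:
  "reflect (g + h) = reflect g + reflect h" "reflect (g * h) = reflect g * reflect h"
  "reflect (smult c g) = smult c (reflect g)"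
  by (simp_all add: reflect_def pcompose_add pcompose_mult pcompose_smult)

lemma degree_reflect: "degree (reflect g) = degree g"
  by (simp add: reflect_def degree_pcompose)

text \<open>With h(x) = g(-x), the reflection turns g(x) into h(x + 1) and g(x + 1) into h(x): it
  exchanges the two arguments that occur in N, E and F.\<close>

lemma reflect_eq_shift1: "reflect g = shift1 (pcompose g [:0, -1:])"
  by (simp add: reflect_def shift1_def pcompose_assoc[symmetric] pcompose_pCons)

lemma reflect_shift1: "reflect (shift1 g) = pcompose g [:0, -1:]"
  by (simp add: reflect_def shift1_def pcompose_assoc[symmetric] pcompose_pCons)

text \<open>Comparing leading coefficients gives s = -1, so the constant coefficient equals its own
  negative.\<close>

lemma pcompose_neg_monic_1:
  assumes "pcompose g [:0, -1:] = smult s g" "lead_coeff g = 1" "degree g = 1"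
  shows "g = [:0, 1 :: rat:]"
proof -
  obtain u v where g: "g = [:u, v:]"
    using assms(3) by (metis degree1_coeffs)
  with assms(2,3) have "v = 1"
    by (auto split: if_splits)
  with assms(1) g show ?thesis
    by (auto simp: pcompose_pCons)
qed

text \<open>Here the leading coefficients give s = 1, which kills the linear coefficient and leaves
  the constant one free.\<close>

lemma pcompose_neg_monic_2:
  assumes "pcompose g [:0, -1:] = smult s g" "lead_coeff g = 1" "degree g = 2"
  shows "g = [:0, 1:]\<^sup>2 + [:coeff g 0 :: rat:]"
proof -
  obtain u v w where g: "g = [:u, v, w:]"
    using assms(3) by (metis degree2_coeffs)
  with assms(2,3) have "w = 1"
    by (auto simp: numeral_2_eq_2 split: if_splits)
  with assms(1) g show ?thesis
    by (auto simp: pcompose_pCons power2_eq_square)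
qed

section \<open>The invariant of the run\<close>

locale tcf_half_power =
  fixes \<epsilon> :: rat and m :: nat and f :: "rat poly"
  assumes eps: "\<epsilon> = 1 \<or> \<epsilon> = -1"
    and m_minus: "\<epsilon> = -1 \<Longrightarrow> m \<ge> 1"
    and m_plus: "\<epsilon> = 1 \<Longrightarrow> m \<ge> 2"
    and f_eq: "f = [:1/2, 1:] ^ m"
begin

definition M :: nat where
  "M = (if \<epsilon> = 1 then m - 1 else m)"

text \<open>The sign is dictated by the start: E_0 = \<epsilon> f and F_0 = -f must be exchanged up
  to the factor \<open>s\<close>, while f itself picks up (-1)^m.\<close>

definition s :: rat where
  "s = - \<epsilon> * (-1) ^ m"

lemma M_pos: "M > 0" and M_le: "M \<le> m"
  using eps m_minus m_plus by (auto simp: M_def)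

lemma degree_f: "degree f = m"
  by (simp add: f_eq degree_power_eq)

lemma f_nonzero: "f \<noteq> 0"
  by (simp add: f_eq)

lemma s_square: "s * s = 1"
  using eps by (auto simp: s_def simp flip: power_add mult_2)

lemma reflect_f: "reflect f = smult ((-1) ^ m) f"
proof -
  have "reflect f = (pcompose [:1/2, 1:] [:-1, -1:]) ^ m"
    unfolding reflect_def f_eq by (induction m) (simp_all only: power_0 power_Suc pcompose_1 pcompose_mult)
  also have "pcompose [:1/2, 1:] [:-1, -1:] = smult (-1) [:1/2, 1 :: rat:]"
    by (simp add: pcompose_pCons)
  finally show ?thesis
    by (simp only: smult_power f_eq)
qed

text \<open>The clause on E + F records, for \<epsilon> = 1, the cancellation that compensates for
  deg E = M + 1. The number \<open>c\<close> stands for a_1 ... a_n; it is used only through being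
  non-zero, hence the existential.\<close>

definition inv_state :: "(nat \<Rightarrow> rat) \<Rightarrow> (nat \<Rightarrow> rat poly) \<Rightarrow> nat \<Rightarrow> bool" where
  "inv_state a b n \<longleftrightarrow>
     degree (cf_N f \<epsilon> a b n) < M \<and> degree (cf_N f \<epsilon> a b (Suc n)) < M \<and>
     degree (cf_E f \<epsilon> a b n) = m \<and> degree (cf_F f \<epsilon> a b n) = m \<and>
     (\<epsilon> = 1 \<longrightarrow> degree (cf_E f \<epsilon> a b n + cf_F f \<epsilon> a b n) \<le> M) \<and>
     reflect (cf_N f \<epsilon> a b n) = cf_N f \<epsilon> a b n \<and>
     reflect (cf_N f \<epsilon> a b (Suc n)) = cf_N f \<epsilon> a b (Suc n) \<and>
     reflect (cf_E f \<epsilon> a b n) = smult s (cf_F f \<epsilon> a b n) \<and>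
     reflect (cf_F f \<epsilon> a b n) = smult s (cf_E f \<epsilon> a b n) \<and>
     (\<exists>c. c \<noteq> 0 \<and> cf_E f \<epsilon> a b n * cf_F f \<epsilon> a b n =
        cf_N f \<epsilon> a b n * cf_N f \<epsilon> a b (Suc n) - smult (\<epsilon> * c\<^sup>2) (f * f))"

lemma inv_state_0: "inv_state a b 0"
proof -
  have N: "cf_N f \<epsilon> a b 0 = 0" "cf_N f \<epsilon> a b (Suc 0) = 1"
    and E: "cf_E f \<epsilon> a b 0 = smult \<epsilon> f" and F: "cf_F f \<epsilon> a b 0 = - f"
    by (simp_all add: cf_N_def cf_E_def cf_F_def shift1_def pcompose_1)
  have "reflect 0 = 0" "reflect 1 = 1" "reflect (- f) = - reflect f"
    by (simp_all add: reflect_def pcompose_1 pcompose_uminus)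
  \<comment> \<open>The witness is the empty product of the a_i.\<close>
  moreover have "\<exists>c::rat. c \<noteq> 0 \<and> smult \<epsilon> f * (- f) = 0 * 1 - smult (\<epsilon> * c\<^sup>2) (f * f)"
    by (rule exI[of _ 1]) simp
  ultimately show ?thesis
    unfolding inv_state_def N E F
    using M_pos eps by (auto simp: degree_f reflect_simps reflect_f s_def)
qed

section \<open>The system as a degree bound\<close>

text \<open>The summand with N_{k-1} has degree 2 d + q = d + M at most and the one with N_{k-2}
  stays below M. Only the E and F terms need care, and only for \<epsilon> = 1.\<close>

lemma degree_rhs:
  assumes inv: "inv_state a b n" and N: "cf_N f \<epsilon> a b (Suc n) \<noteq> 0"
    and deg: "degree \<beta> + degree (cf_N f \<epsilon> a b (Suc n)) = M"
  shows "degree (tcf_rhs f \<epsilon> a b n \<alpha> \<beta>) \<le> degree \<beta> + M"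
proof -
  let ?L = "cf_N f \<epsilon> a b n" and ?N = "cf_N f \<epsilon> a b (Suc n)"
    and ?E = "cf_E f \<epsilon> a b n" and ?F = "cf_F f \<epsilon> a b n"
  have "degree (\<beta> * shift1 \<beta> * ?N) \<le> degree \<beta> + M"
    using degree_mult_le[of "\<beta> * shift1 \<beta>" ?N] degree_mult_le[of \<beta> "shift1 \<beta>"] deg
    by (simp add: degree_shift1)
  moreover have "degree (smult (\<alpha>\<^sup>2) ?L) \<le> degree \<beta> + M"
    using degree_smult_le[of "\<alpha>\<^sup>2" ?L] inv by (simp add: inv_state_def)
  moreover have "degree (\<beta> * ?E + shift1 \<beta> * ?F) \<le> degree \<beta> + M"
  proof (cases "\<epsilon> = 1")
    case False
    then show ?thesis
      using degree_mult_le[of \<beta> ?E] degree_mult_le[of "shift1 \<beta>" ?F] inv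
      by (intro degree_add_le) (auto simp: inv_state_def M_def degree_shift1)
  next
    case True
    \<comment> \<open>Here $\deg E = \deg F = M + 1$, and the leading terms cancel.\<close>
    have "\<beta> * ?E + shift1 \<beta> * ?F = \<beta> * (?E + ?F) + (shift1 \<beta> - \<beta>) * ?F"
      by (simp add: algebra_simps)
    moreover have "degree (\<beta> * (?E + ?F)) \<le> degree \<beta> + M"
    proof -
      have "degree (?E + ?F) \<le> M"
        using inv True unfolding inv_state_def by blast
      then show ?thesis
        using degree_mult_le[of \<beta> "?E + ?F"] by linarith
    qed
    \<comment> \<open>For non-constant \<beta> the difference loses one degree, which makes up for
      the extra one in deg F = M + 1; for constant \<beta> it vanishes.\<close>
    moreover have "degree ((shift1 \<beta> - \<beta>) * ?F) \<le> degree \<beta> + M"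
    proof (cases "degree \<beta> = 0")
      case True
      then obtain c where "\<beta> = [:c:]"
        using degree_eq_zeroE by blast
      then show ?thesis
        by (simp add: shift1_def)
    next
      case False
      moreover have "degree ?F = M + 1"
        using inv \<open>\<epsilon> = 1\<close> m_plus unfolding inv_state_def M_def by auto
      ultimately show ?thesis
        using degree_mult_le[of "shift1 \<beta> - \<beta>" ?F] degree_shift1_diff[of \<beta>] by linarith
    qed
    ultimately show ?thesis
      by (simp add: degree_add_le)
  qed
  then have "degree (smult \<alpha> (\<beta> * ?E + shift1 \<beta> * ?F)) \<le> degree \<beta> + M"
    using degree_smult_le order_trans by blast
  ultimately have "degree (\<beta> * shift1 \<beta> * ?N + smult (\<alpha>\<^sup>2) ?L
      + smult \<alpha> (\<beta> * ?E + shift1 \<beta> * ?F)) \<le> degree \<beta> + M"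
    by (intro degree_add_le)
  then show ?thesis
    by (simp add: tcf_rhs_def smult_add_right add.assoc)
qed

text \<open>The equations kill the coefficients from d + q = M to 2 d + q = d + M, and
  \<open>degree_rhs\<close> leaves none above.\<close>

lemma tcf_solution_iff:
  assumes inv: "inv_state a b n" and N: "cf_N f \<epsilon> a b (Suc n) \<noteq> 0"
  shows "tcf_solution f \<epsilon> a b n (\<alpha>, \<beta>) \<longleftrightarrow>
    lead_coeff \<beta> = 1 \<and> degree \<beta> + degree (cf_N f \<epsilon> a b (Suc n)) = M \<and>
    degree (tcf_rhs f \<epsilon> a b n \<alpha> \<beta>) < M"
proof -
  let ?q = "degree (cf_N f \<epsilon> a b (Suc n))" and ?R = "tcf_rhs f \<epsilon> a b n \<alpha> \<beta>"
  have "m \<ge> 1"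
    using eps m_minus m_plus by auto
  \<comment> \<open>A positive degree rules out E = 0, the case excluded in
    \<open>tcf_solution\<close>.\<close>
  then have E: "cf_E f \<epsilon> a b n \<noteq> 0"
    using inv by (auto simp: inv_state_def)
  have d: "int (degree \<beta>) = tcf_deg f \<epsilon> a b n \<longleftrightarrow> degree \<beta> + ?q = M"
    using inv \<open>m \<ge> 1\<close> by (auto simp: tcf_deg_def inv_state_def M_def)
  have "(\<forall>i\<in>{degree \<beta> + ?q..2 * degree \<beta> + ?q}. coeff ?R i = 0) \<longleftrightarrow> degree ?R < M"
    if deg: "degree \<beta> + ?q = M"
  proof
    assume R: "\<forall>i\<in>{degree \<beta> + ?q..2 * degree \<beta> + ?q}. coeff ?R i = 0"
    show "degree ?R < M"
    proof (rule degree_lessI)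
      \<comment> \<open>The zero polynomial has degree 0, so M > 0 is what makes the strict bound
        hold for it.\<close>
      show "?R \<noteq> 0 \<or> M > 0"
        using M_pos by blast
      show "\<forall>i\<ge>M. coeff ?R i = 0"
      proof (intro allI impI)
        fix i assume "M \<le> i"
        show "coeff ?R i = 0"
        proof (cases "i \<le> degree \<beta> + M")
          case True
          with R \<open>M \<le> i\<close> deg show ?thesis by auto
        next
          case False
          with degree_rhs[OF inv N deg, of \<alpha>] show ?thesis
            by (intro coeff_eq_0) simp
        qed
      qed
    qed
  qed (use that in \<open>auto intro: coeff_eq_0\<close>)
  then show ?thesis
    using E d by (auto simp: tcf_solution_def Let_def)
qed

section \<open>Symmetry of the solutions\<close>

text \<open>The sign \<tau> is there to make \<beta>(-x) monic. The factor \<tau> s in the new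
  \<alpha> cancels this \<tau> in the mixed terms and absorbs the sign from exchanging E and F; all
  other terms contain squares of signs.\<close>

lemma reflect_rhs:
  assumes inv: "inv_state a b n" and "\<tau> * \<tau> = 1"
  shows "tcf_rhs f \<epsilon> a b n (\<alpha> * \<tau> * s) (smult \<tau> (pcompose \<beta> [:0, -1:])) =
    reflect (tcf_rhs f \<epsilon> a b n \<alpha> \<beta>)"
proof -
  have *: "(\<alpha> * \<tau> * s)\<^sup>2 = \<alpha>\<^sup>2" "\<tau> * (\<alpha> * \<tau> * s) = \<alpha> * s"
    using assms(2) s_square by (simp_all add: power2_eq_square algebra_simps)
  let ?\<gamma> = "pcompose \<beta> [:0, -1:]"
  have "tcf_rhs f \<epsilon> a b n (\<alpha> * \<tau> * s) (smult \<tau> ?\<gamma>) =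
      smult (\<tau> * \<tau>) (?\<gamma> * shift1 ?\<gamma> * cf_N f \<epsilon> a b (Suc n))
      + smult ((\<alpha> * \<tau> * s)\<^sup>2) (cf_N f \<epsilon> a b n)
      + smult (\<tau> * (\<alpha> * \<tau> * s)) (?\<gamma> * cf_E f \<epsilon> a b n)
      + smult (\<tau> * (\<alpha> * \<tau> * s)) (shift1 ?\<gamma> * cf_F f \<epsilon> a b n)"
    by (simp add: tcf_rhs_def shift1_smult mult_ac)
  also have "\<dots> = reflect (tcf_rhs f \<epsilon> a b n \<alpha> \<beta>)"
    using inv unfolding * assms(2) tcf_rhs_def
    by (simp add: reflect_simps reflect_shift1 inv_state_def reflect_eq_shift1[of \<beta>] mult_ac add_ac)
  finally show ?thesis .
qed

text \<open>The reflected solution, made monic, solves the same system and so coincides with the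
  given one; comparing both components identifies the sign.\<close>

lemma solution_parity:
  assumes inv: "inv_state a b n" and N: "cf_N f \<epsilon> a b (Suc n) \<noteq> 0"
    and sol: "tcf_solution f \<epsilon> a b n (\<alpha>, \<beta>)"
    and uniq: "\<And>\<alpha>' \<beta>'. tcf_solution f \<epsilon> a b n (\<alpha>', \<beta>') \<Longrightarrow> \<alpha>' = \<alpha> \<and> \<beta>' = \<beta>"
  shows "\<alpha> \<noteq> 0" "pcompose \<beta> [:0, -1:] = smult s \<beta>"
proof -
  have *: "lead_coeff \<beta> = 1" "degree \<beta> + degree (cf_N f \<epsilon> a b (Suc n)) = M"
      "degree (tcf_rhs f \<epsilon> a b n \<alpha> \<beta>) < M"
    using sol tcf_solution_iff[OF inv N] by blast+
  \<comment> \<open>For \<alpha> = 0 only the N_{k-1} term is left, whose degree is exactly deg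
    \<beta> + M, too large for a solution.\<close>
  show "\<alpha> \<noteq> 0"
  proof
    assume "\<alpha> = 0"
    then have "tcf_rhs f \<epsilon> a b n \<alpha> \<beta> = \<beta> * shift1 \<beta> * cf_N f \<epsilon> a b (Suc n)"
      by (simp add: tcf_rhs_def)
    moreover have "\<beta> \<noteq> 0" "shift1 \<beta> \<noteq> 0"
      using *(1) lead_coeff_shift1[of \<beta>] by auto
    ultimately have "degree (tcf_rhs f \<epsilon> a b n \<alpha> \<beta>) = degree \<beta> + M"
      using N *(2) by (simp add: degree_mult_eq degree_shift1)
    with *(3) show False by simp
  qed
  \<comment> \<open>This is the leading coefficient of \<beta>(-x).\<close>
  define \<tau> :: rat where "\<tau> = (-1) ^ degree \<beta>"
  have \<tau>: "\<tau> * \<tau> = 1"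
    by (simp add: \<tau>_def flip: power_add mult_2)
  then have "\<tau> \<noteq> 0" by auto
  let ?\<beta> = "smult \<tau> (pcompose \<beta> [:0, -1:])"
  have "degree ?\<beta> = degree \<beta>"
    using \<open>\<tau> \<noteq> 0\<close> by (simp add: degree_pcompose)
  moreover have "lead_coeff ?\<beta> = 1"
    using lead_coeff_comp[of "[:0, -1:]" \<beta>] *(1) \<tau> \<open>\<tau> \<noteq> 0\<close>
    by (simp add: \<tau>_def)
  ultimately have "tcf_solution f \<epsilon> a b n (\<alpha> * \<tau> * s, ?\<beta>)"
    using * tcf_solution_iff[OF inv N] reflect_rhs[OF inv \<tau>] by (simp add: degree_reflect)
  from uniq[OF this] have eq: "\<alpha> * \<tau> * s = \<alpha>" "?\<beta> = \<beta>"
    by auto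
  \<comment> \<open>The first component forces \<tau> = s, so the parity of \<beta> is the same at
    every step.\<close>
  from eq(1) \<open>\<alpha> \<noteq> 0\<close> have "\<tau> * s = 1"
    by (simp add: mult.assoc)
  with s_square have "\<tau> = s"
    by (metis mult.assoc mult.left_neutral mult.right_neutral)
  with eq(2) have "smult s (smult s (pcompose \<beta> [:0, -1:])) = smult s \<beta>"
    by simp
  then show "pcompose \<beta> [:0, -1:] = smult s \<beta>"
    using s_square by simp
qed

section \<open>Preservation of the invariant\<close>

lemma inv_state_Suc:
  assumes inv: "inv_state a b n" and N: "cf_N f \<epsilon> a b (Suc n) \<noteq> 0"
    and deg: "degree (b (Suc n)) + degree (cf_N f \<epsilon> a b (Suc n)) = M"
    and deg_rhs: "degree (tcf_rhs f \<epsilon> a b n (a (Suc n)) (b (Suc n))) < M"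
    and a: "a (Suc n) \<noteq> 0"
    and parity: "pcompose (b (Suc n)) [:0, -1:] = smult s (b (Suc n))"
  shows "inv_state a b (Suc n)"
proof -
  define \<alpha> \<beta> where "\<alpha> = a (Suc n)" and "\<beta> = b (Suc n)"
  define N0 N1 N2 E F where "N0 = cf_N f \<epsilon> a b n" and "N1 = cf_N f \<epsilon> a b (Suc n)"
    and "N2 = cf_N f \<epsilon> a b (Suc (Suc n))"
    and "E = cf_E f \<epsilon> a b n" and "F = cf_F f \<epsilon> a b n"
  define E' F' where "E' = cf_E f \<epsilon> a b (Suc n)" and "F' = cf_F f \<epsilon> a b (Suc n)"
  have E': "E' = \<beta> * N1 + smult \<alpha> F" and F': "F' = shift1 \<beta> * N1 + smult \<alpha> E"
    by (simp_all add: E'_def F'_def E_def F_def N1_def \<alpha>_def \<beta>_def cf_E_Suc cf_F_Suc)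
  have N2: "N2 = \<beta> * shift1 \<beta> * N1 + smult (\<alpha>\<^sup>2) N0 + smult \<alpha> (\<beta> * E) + smult \<alpha> (shift1 \<beta> * F)"
    by (simp add: N2_def \<alpha>_def \<beta>_def cf_N_Suc_Suc tcf_rhs_def N0_def N1_def E_def F_def)
  have dN2: "degree N2 < M"
    using deg_rhs by (simp add: N2_def cf_N_Suc_Suc)
  have dN1: "degree N1 < M" and dE: "degree E = m" and dF: "degree F = m"
    and rN0: "reflect N0 = N0" and rN1: "reflect N1 = N1"
    and rE: "reflect E = smult s F" and rF: "reflect F = smult s E"
    using inv by (simp_all add: inv_state_def N0_def N1_def E_def F_def)
  have dEF: "\<epsilon> = 1 \<Longrightarrow> degree (E + F) \<le> M"
    using inv unfolding inv_state_def E_def F_def by blast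
  obtain c where "c \<noteq> 0" and c: "E * F = N0 * N1 - smult (\<epsilon> * c\<^sup>2) (f * f)"
    using inv by (auto simp: inv_state_def N0_def N1_def E_def F_def)
  have "\<alpha> \<noteq> 0"
    using a by (simp add: \<alpha>_def)
  have deg': "degree \<beta> + degree N1 = M"
    using deg by (simp add: \<beta>_def N1_def)
  have r\<beta>: "reflect \<beta> = smult s (shift1 \<beta>)" "reflect (shift1 \<beta>) = smult s \<beta>"
    using parity by (simp_all add: reflect_eq_shift1[of "b (Suc n)"] reflect_shift1 shift1_smult \<beta>_def)
  \<comment> \<open>A determinant identity: the matrix G with rows (N1, E), (F, N0) becomes A G B,
    where A has rows (\<beta>, \<alpha>), (1, 0) and B is the transpose of A with \<beta> shifted.
    Both have determinant -\<alpha>, so det G is multiplied by the square of \<alpha>.\<close>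
  have "E' * F' - N1 * N2 = smult (\<alpha>\<^sup>2) (E * F - N0 * N1)"
    unfolding E' F' N2 by (simp add: algebra_simps smult_add_right smult_diff_right power2_eq_square)
  then have c': "E' * F' = N1 * N2 - smult (\<epsilon> * (\<alpha> * c)\<^sup>2) (f * f)"
    by (simp add: c power2_eq_square algebra_simps)
  have dbN: "degree (\<beta> * N1) \<le> M" "degree (shift1 \<beta> * N1) \<le> M"
    using degree_mult_le[of \<beta> N1] degree_mult_le[of "shift1 \<beta>" N1] deg'
    by (simp_all add: degree_shift1)
  then have "degree E' \<le> m" "degree F' \<le> m"
    unfolding E' F' using M_le dE dF degree_smult_le[of \<alpha> E] degree_smult_le[of \<alpha> F]
    by (auto intro!: degree_add_le)
  \<comment> \<open>The N-product has degree below 2 m, so the f-square term decides. Since neither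
    factor exceeds degree m, both must attain it.\<close>
  moreover have "degree (E' * F') = 2 * m"
  proof -
    have "degree (N1 * N2) < 2 * m"
      using degree_mult_le[of N1 N2] dN1 dN2 M_le by simp
    moreover have "degree (smult (\<epsilon> * (\<alpha> * c)\<^sup>2) (f * f)) = 2 * m"
      using eps \<open>c \<noteq> 0\<close> \<open>\<alpha> \<noteq> 0\<close> f_nonzero by (auto simp: degree_mult_eq degree_f)
    ultimately show ?thesis
      unfolding c' using degree_add_eq_right[of "N1 * N2" "- smult (\<epsilon> * (\<alpha> * c)\<^sup>2) (f * f)"]
      by simp
  qed
  ultimately have dE': "degree E' = m" and dF': "degree F' = m"
    using degree_mult_le[of E' F'] by linarith+
  \<comment> \<open>The bound on the sum is inherited directly: E and F enter E' + F' only through E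
    + F.\<close>
  have "degree (E' + F') \<le> M" if "\<epsilon> = 1"
  proof -
    have "E' + F' = (\<beta> * N1 + shift1 \<beta> * N1) + smult \<alpha> (E + F)"
      by (simp add: E' F' smult_add_right)
    also have "degree \<dots> \<le> M"
      using dbN dEF[OF that] degree_smult_le[of \<alpha> "E + F"] by (intro degree_add_le) auto
    finally show ?thesis .
  qed
  moreover have "reflect E' = smult s F'" "reflect F' = smult s E'"
    unfolding E' F'
    by (simp_all add: reflect_simps r\<beta> rN1 rE rF smult_add_right mult.commute)
  moreover have "reflect N2 = N2"
    unfolding N2
    by (simp add: reflect_simps r\<beta> rN1 rN0 rE rF s_square algebra_simps)
  moreover have "\<alpha> * c \<noteq> 0"
    using \<open>\<alpha> \<noteq> 0\<close> \<open>c \<noteq> 0\<close> by simp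
  ultimately show ?thesis
    unfolding inv_state_def N1_def[symmetric] N2_def[symmetric] E'_def[symmetric] F'_def[symmetric]
    using dN1 dN2 dE' dF' rN1 c' by blast
qed

lemma run_inv_state: "tcf_run f \<epsilon> n = Some (a, b) \<Longrightarrow> inv_state a b n"
proof (induction n arbitrary: a b)
  case 0
  then show ?case by (simp add: inv_state_0)
next
  case (Suc n)
  obtain a' b' \<alpha> \<beta> where run: "tcf_run f \<epsilon> n = Some (a', b')"
    and N: "cf_N f \<epsilon> a' b' (Suc n) \<noteq> 0" and sol: "tcf_solution f \<epsilon> a' b' n (\<alpha>, \<beta>)"
    and uniq: "\<And>\<alpha>' \<beta>'. tcf_solution f \<epsilon> a' b' n (\<alpha>', \<beta>') \<Longrightarrow> \<alpha>' = \<alpha> \<and> \<beta>' = \<beta>"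
    and a: "a = a'(Suc n := \<alpha>)" and b: "b = b'(Suc n := \<beta>)"
    using tcf_run_SucE[OF Suc.prems] by metis
  have inv: "inv_state a' b' n"
    using Suc.IH run by blast
  have eqs: "cf_N f \<epsilon> a b n = cf_N f \<epsilon> a' b' n"
    "cf_N f \<epsilon> a b (Suc n) = cf_N f \<epsilon> a' b' (Suc n)"
    "cf_E f \<epsilon> a b n = cf_E f \<epsilon> a' b' n" "cf_F f \<epsilon> a b n = cf_F f \<epsilon> a' b' n"
    by (auto intro!: cf_N_cong cf_EF_cong simp: a b)
  show ?case
  proof (rule inv_state_Suc)
    show "inv_state a b n"
      using inv unfolding inv_state_def eqs .
    show "cf_N f \<epsilon> a b (Suc n) \<noteq> 0"
      using N by (simp add: eqs)
    show "degree (b (Suc n)) + degree (cf_N f \<epsilon> a b (Suc n)) = M"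
      using sol tcf_solution_iff[OF inv N] by (simp add: eqs, simp add: b)
    show "degree (tcf_rhs f \<epsilon> a b n (a (Suc n)) (b (Suc n))) < M"
      using sol tcf_solution_iff[OF inv N] by (simp add: tcf_rhs_def eqs, simp add: a b)
    \<comment> \<open>Uniqueness of the solution enters the invariant here, through the parity of
      b.\<close>
    show "a (Suc n) \<noteq> 0" "pcompose (b (Suc n)) [:0, -1:] = smult s (b (Suc n))"
      using solution_parity[OF inv N sol uniq] by (simp_all add: a b)
  qed
qed

section \<open>Degrees along the run and the equivalence\<close>

text \<open>Retains what the equivalence needs from a completed step: the link between deg b_{n+1}
  and deg N_n, and the shape of b_{n+1}.\<close>

lemma run_Suc_step:
  assumes "tcf_run f \<epsilon> (Suc n) = Some (a, b)"
  obtains a' b' where "tcf_run f \<epsilon> n = Some (a', b')" "cf_N f \<epsilon> a' b' (Suc n) \<noteq> 0"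
    "degree (b (Suc n)) + degree (cf_N f \<epsilon> a' b' (Suc n)) = M"
    "lead_coeff (b (Suc n)) = 1" "pcompose (b (Suc n)) [:0, -1:] = smult s (b (Suc n))"
proof -
  obtain a' b' \<alpha> \<beta> where run: "tcf_run f \<epsilon> n = Some (a', b')"
    and N: "cf_N f \<epsilon> a' b' (Suc n) \<noteq> 0" and sol: "tcf_solution f \<epsilon> a' b' n (\<alpha>, \<beta>)"
    and uniq: "\<And>\<alpha>' \<beta>'. tcf_solution f \<epsilon> a' b' n (\<alpha>', \<beta>') \<Longrightarrow> \<alpha>' = \<alpha> \<and> \<beta>' = \<beta>"
    and b: "b = b'(Suc n := \<beta>)"
    using tcf_run_SucE[OF assms] by metis
  note inv = run_inv_state[OF run]
  show ?thesis
    using that[OF run N] solution_parity[OF inv N sol uniq] sol tcf_solution_iff[OF inv N]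
    by (simp add: b)
qed

text \<open>The parity test says exactly that M is odd. So M is an even number, the degree in (A),
  plus 1 or 2, the degree of b_k in (B).\<close>

lemma degree_N_target:
  "(if \<epsilon> = -1 then 2 * ((m - 1) div 2) else 2 * ((m - 2) div 2)) +
     (if (if \<epsilon> = -1 then odd m else even m) then 1 else 2) = M"
proof (cases "\<epsilon> = -1")
  case True
  then have "M = m" "m \<ge> 1"
    using m_minus unfolding M_def by simp_all
  moreover from this(2) have "2 * ((m - 1) div 2) + (if odd m then 1 else 2) = m"
    by (cases "odd m") (auto elim!: oddE evenE)
  ultimately show ?thesis
    using True by (simp only: if_True refl)
next
  case False
  then have "M = m - 1" "m \<ge> 2"
    using eps m_plus unfolding M_def by auto
  moreover from this(2) have "2 * ((m - 2) div 2) + (if even m then 1 else 2) = m - 1"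
    by (cases "odd m") (auto elim!: oddE evenE)
  ultimately show ?thesis
    using False by (simp only: if_False)
qed

end

theorem theorem1:
  fixes \<epsilon> :: rat and m :: nat and f :: "rat poly"
  assumes eps: "\<epsilon> \<in> {1, -1}"
    and m_minus: "\<epsilon> = -1 \<Longrightarrow> m \<ge> 1"
    and m_plus: "\<epsilon> = 1 \<Longrightarrow> m \<ge> 2"
    and f: "f = [:1/2, 1:] ^ m"
  shows
    "(\<forall>k\<ge>1. \<exists>a b. tcf_run f \<epsilon> k = Some (a, b) \<and>
        cf_N f \<epsilon> a b (Suc k) \<noteq> 0 \<and>
        degree (cf_N f \<epsilon> a b (Suc k)) =
          (if \<epsilon> = -1 then 2 * ((m - 1) div 2) else 2 * ((m - 2) div 2)))
     \<longleftrightarrow>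
     ((\<forall>k. tcf_run f \<epsilon> k \<noteq> None) \<and>
      (if (if \<epsilon> = -1 then odd m else even m)
       then \<forall>k\<ge>2. \<forall>a b. tcf_run f \<epsilon> k = Some (a, b) \<longrightarrow> b k = [:0, 1:]
       else \<exists>c :: nat \<Rightarrow> rat. \<forall>k\<ge>2. \<forall>a b. tcf_run f \<epsilon> k = Some (a, b) \<longrightarrow>
              b k = [:0, 1:]\<^sup>2 + [:c k:]))"
proof -
  interpret tcf_half_power \<epsilon> m f
    using assms by unfold_locales auto
  define P where "P \<longleftrightarrow> (if \<epsilon> = -1 then odd m else even m)"
  define e d where "e = (if \<epsilon> = -1 then 2 * ((m - 1) div 2) else 2 * ((m - 2) div 2))"
    and "d = (if P then 1 else 2 :: nat)"
  have ed: "e + d = M"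
    using degree_N_target by (simp only: e_def d_def P_def)
  let ?A = "\<forall>k\<ge>1. \<exists>a b. tcf_run f \<epsilon> k = Some (a, b) \<and> cf_N f \<epsilon> a b (Suc k) \<noteq> 0 \<and>
        degree (cf_N f \<epsilon> a b (Suc k)) = e"
  let ?x = "\<forall>k\<ge>2. \<forall>a b. tcf_run f \<epsilon> k = Some (a, b) \<longrightarrow> b k = [:0, 1:]"
  let ?x2 = "\<exists>c :: nat \<Rightarrow> rat. \<forall>k\<ge>2. \<forall>a b. tcf_run f \<epsilon> k = Some (a, b) \<longrightarrow>
              b k = [:0, 1:]\<^sup>2 + [:c k:]"
  let ?B = "(\<forall>k. tcf_run f \<epsilon> k \<noteq> None) \<and> (if P then ?x else ?x2)"
  have "?A \<longleftrightarrow> ?B"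
  proof
    assume A: ?A
    have total: "tcf_run f \<epsilon> k \<noteq> None" for k
    proof (cases "k = 0")
      case False
      then have "k \<ge> 1" by simp
      with A show ?thesis by fastforce
    qed simp
    have step: "degree (b k) = d \<and> lead_coeff (b k) = 1 \<and>
        pcompose (b k) [:0, -1:] = smult s (b k)"
      if k: "k \<ge> 2" and run: "tcf_run f \<epsilon> k = Some (a, b)" for k a b
    proof -
      \<comment> \<open>(A) starts at N_1, so it controls b_{n+1} only for n >= 1; N_0 = 1 need not
        have the degree in question.\<close>
      obtain n where n: "k = Suc n" "n \<ge> 1"
        using k by (cases k) auto
      obtain a' b' where "tcf_run f \<epsilon> n = Some (a', b')"
        and deg: "degree (b (Suc n)) + degree (cf_N f \<epsilon> a' b' (Suc n)) = M"
        and b: "lead_coeff (b (Suc n)) = 1" "pcompose (b (Suc n)) [:0, -1:] = smult s (b (Suc n))"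
        using run_Suc_step run n(1) by metis
      moreover from this(1) have "degree (cf_N f \<epsilon> a' b' (Suc n)) = e"
        using A n(2) by fastforce
      ultimately show ?thesis
        using ed n(1) by auto
    qed
    have x: ?x if "d = 1"
      using step pcompose_neg_monic_1 that by metis
    have x2: ?x2 if "d = 2"
    proof (intro exI allI impI)
      fix k a b assume "2 \<le> k" and run: "tcf_run f \<epsilon> k = Some (a, b)"
      then have "b k = [:0, 1:]\<^sup>2 + [:coeff (b k) 0:]"
        using step[of k a b] that pcompose_neg_monic_2 by metis
      \<comment> \<open>The constants must be one function of k chosen before \<open>a\<close> and
        \<open>b\<close>, so they are read off from the run itself.\<close>
      then show "b k = [:0, 1:]\<^sup>2 + [:coeff (snd (the (tcf_run f \<epsilon> k)) k) 0:]"
        using run by simp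
    qed
    show ?B
    proof (cases P)
      case True
      with x total show ?thesis
        by (simp add: d_def)
    next
      case False
      with x2 total show ?thesis
        by (simp add: d_def)
    qed
  next
    assume B: ?B
    have deg_b: "degree (b k) = d" if "k \<ge> 2" "tcf_run f \<epsilon> k = Some (a, b)" for k a b
    proof (cases P)
      case True
      with B that have "b k = [:0, 1:]"
        by metis
      with True show ?thesis
        by (simp add: d_def)
    next
      case False
      with B that obtain c where "b k = [:0, 1:]\<^sup>2 + [:c:]"
        by metis
      with False show ?thesis
        by (simp add: d_def power2_eq_square)
    qed
    show ?A
    proof (intro allI impI)
      fix k :: nat assume k: "1 \<le> k"
      \<comment> \<open>One step further is run because N_k is tested for zero, and its degree tied
        to that of b_{k+1}, only at step k + 1.\<close>
      obtain a b where run: "tcf_run f \<epsilon> (Suc k) = Some (a, b)"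
        using B by (metis not_None_eq surj_pair)
      obtain a' b' where "tcf_run f \<epsilon> k = Some (a', b')" "cf_N f \<epsilon> a' b' (Suc k) \<noteq> 0"
        "degree (b (Suc k)) + degree (cf_N f \<epsilon> a' b' (Suc k)) = M"
        using run_Suc_step[OF run] by metis
      moreover have "degree (b (Suc k)) = d"
        using deg_b[OF _ run] k by simp
      ultimately show "\<exists>a b. tcf_run f \<epsilon> k = Some (a, b) \<and> cf_N f \<epsilon> a b (Suc k) \<noteq> 0 \<and>
        degree (cf_N f \<epsilon> a b (Suc k)) = e"
        using ed by auto
    qed
  qed
  then show ?thesis
    unfolding e_def P_def .
qed

end
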